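(* For every countable field $F$, $\mathfrak{b}\leq\mathfrak{a}_{\mathrm{vec},F}$.
   Context: $F$ is a countable (possibly finite) field, $E$ is a vector space over $F$ of countably infinite dimension, and $(e_n)_{n\in\omega}$ is a fixed $F$-basis of $E$. For $x\in E$, $\mathrm{supp}(x)$ is the (finite) set of $n\in\omega$ such that $e_n$ has nonzero coefficient in the expansion of $x$. For nonzero $x,y\in E$, write $x<y$ if $\max(\mathrm{supp}(x))<\min(\mathrm{supp}(y))$. A block sequence is a sequence $(x_n)$ of nonzero vectors with $x_n<x_{n+1}$ for all $n$; a block subspace is the linear span of an infinite block sequence. Two infinite-dimensional subspaces $X,Y$ of $E$ are almost disjoint if $X\cap Y$ is finite-dimensional. An almost disjoint family of block subspaces is a set of pairwise almost disjoint block subspaces; it is a mad family of block subspaces if it is not properly contained in another such family. Define $\mathfrak{a}_{\mathrm{vec},F}=\min\{|\mathcal{A}|:\mathcal{A}\text{ is an infinite mad family of block subspaces of }E\}$. For $f,g\in\omega^\omega$, $f<^*g$ means there is $N$ with $f(n)<g(n)$ for all $n\geq N$. A family $\mathcal{B}\subseteq\omega^\omega$ is bounded if there is $h\in\omega^\omega$ with $f<^*h$ for all $f\in\mathcal{B}$, and unbounded otherwise. $\mathfrak{b}$ is the minimum cardinality of an unbounded family in $\omega^\omega$. *)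

theory Defs
  imports Complex_Main "HOL-Library.Countable_Set"
begin

unbundle cardinal_syntax

text \<open>
  The minimum of the cardinalities of the members of \<open>K\<close>, as a cardinal order.  It is meaningful only
  for \<open>K \<noteq> {}\<close>, and determined up to \<open>=o\<close>; see \<open>min_card_attained\<close> and \<open>min_card_least\<close>.
\<close>

definition min_card :: "'a set set \<Rightarrow> 'a rel" where
  "min_card K = |SOME A. A \<in> K \<and> (\<forall>B\<in>K. |A| \<le>o |B| )|"

lemma min_card_attained_least:
  assumes "K \<noteq> {}"
  shows "\<exists>A\<in>K. min_card K = |A| \<and> (\<forall>B\<in>K. |A| \<le>o |B| )"
proof -
  have "\<exists>r\<in>card_of ` K. \<forall>r'\<in>card_of ` K. r \<le>o r'"
    using assms by (intro exists_minim_Card_order) (auto simp: card_of_Card_order)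
  then have "\<exists>A. A \<in> K \<and> (\<forall>B\<in>K. |A| \<le>o |B| )"
    by auto
  from someI_ex[OF this] show ?thesis
    unfolding min_card_def by blast
qed

lemma min_card_attained: "K \<noteq> {} \<Longrightarrow> \<exists>A\<in>K. min_card K = |A|"
  using min_card_attained_least by blast

lemma min_card_least: "B \<in> K \<Longrightarrow> min_card K \<le>o |B|"
  using min_card_attained_least[of K] by fastforce

definition eventually_less :: "(nat \<Rightarrow> nat) \<Rightarrow> (nat \<Rightarrow> nat) \<Rightarrow> bool" (infix \<open><\<^sup>*\<close> 50) where
  "f <\<^sup>* g \<longleftrightarrow> (\<exists>N. \<forall>n\<ge>N. f n < g n)"

definition bounded_family :: "(nat \<Rightarrow> nat) set \<Rightarrow> bool" where
  "bounded_family B \<longleftrightarrow> (\<exists>h. \<forall>f\<in>B. f <\<^sup>* h)"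

definition bounding_number :: "(nat \<Rightarrow> nat) rel" (\<open>\<bb>\<close>) where
  "\<bb> = min_card {B. \<not> bounded_family B}"

locale vector_space_nat_basis = vector_space scale
  for scale :: "'f::field \<Rightarrow> 'v::ab_group_add \<Rightarrow> 'v" +
  fixes e :: "nat \<Rightarrow> 'v"
  assumes inj_basis: "inj e"
    and independent_basis: "independent (range e)"
    and span_basis: "span (range e) = UNIV"
begin

definition supp :: "'v \<Rightarrow> nat set" where
  "supp x = {n. representation (range e) x (e n) \<noteq> 0}"

text \<open>Used only for nonzero vectors, whose supports are finite and nonempty.\<close>

definition block_less :: "'v \<Rightarrow> 'v \<Rightarrow> bool" where
  "block_less x y \<longleftrightarrow> Max (supp x) < Min (supp y)"

definition block_sequence :: "(nat \<Rightarrow> 'v) \<Rightarrow> bool" where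
  "block_sequence x \<longleftrightarrow> (\<forall>n. x n \<noteq> 0) \<and> (\<forall>n. block_less (x n) (x (Suc n)))"

definition block_subspace :: "'v set \<Rightarrow> bool" where
  "block_subspace X \<longleftrightarrow> (\<exists>x. block_sequence x \<and> X = span (range x))"

definition finite_dim :: "'v set \<Rightarrow> bool" where
  "finite_dim W \<longleftrightarrow> (\<exists>B. finite B \<and> span B = W)"

text \<open>Used only for block subspaces, which are infinite-dimensional.\<close>

definition almost_disjoint :: "'v set \<Rightarrow> 'v set \<Rightarrow> bool" where
  "almost_disjoint X Y \<longleftrightarrow> finite_dim (X \<inter> Y)"

definition ad_family :: "'v set set \<Rightarrow> bool" where
  "ad_family \<A> \<longleftrightarrow> (\<forall>X\<in>\<A>. block_subspace X) \<and> pairwise almost_disjoint \<A>"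

definition mad_family :: "'v set set \<Rightarrow> bool" where
  "mad_family \<A> \<longleftrightarrow> ad_family \<A> \<and> \<not> (\<exists>\<B>. ad_family \<B> \<and> \<A> \<subset> \<B>)"

definition a_vec :: "'v set rel" where
  "a_vec = min_card {\<A>. mad_family \<A> \<and> infinite \<A>}"

end

end

theory Submission
  imports Defs
begin

text \<open>
  Let \<open>\<A>\<close> be an infinite almost disjoint family, and choose distinct \<open>X\<^sub>0, X\<^sub>1, \<dots>\<close> in it.  Call \<open>m\<close> a
  cut of \<open>Y\<close> if truncating a vector of \<open>Y\<close> to its coordinates below \<open>m\<close> stays in \<open>Y\<close>; a block
  subspace has arbitrarily large cuts.  For \<open>Y \<in> \<A>\<close> let \<open>f\<^sub>Y(k)\<close> be so large that it bounds the supports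
  of the vectors of \<open>X\<^sub>k \<inter> Y\<close> (when \<open>X\<^sub>k \<noteq> Y\<close>) and that \<open>Y\<close> has a cut in \<open>[k, f\<^sub>Y(k)]\<close>.  Suppose \<open>h\<close>
  eventually dominates every \<open>f\<^sub>Y\<close>.  Choose a block sequence of vectors \<open>z\<^sub>k \<in> X\<^sub>k\<close> whose supports begin
  beyond \<open>h(k)\<close> and leave gaps prescribed by \<open>h\<close>.  Then for each \<open>Y\<close> and almost all \<open>k\<close>, \<open>z\<^sub>k \<notin> Y\<close> and
  \<open>Y\<close> has a cut between \<open>z\<^sub>k\<close> and \<open>z\<^sub>k\<^sub>+\<^sub>1\<close>.  Truncation at these cuts strips the late \<open>z\<^sub>k\<close> off any
  vector of \<open>Y\<close> in the span of the \<open>z\<^sub>k\<close>, so this span is almost disjoint from every \<open>Y \<in> \<A>\<close> and \<open>\<A>\<close>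
  is not maximal.  Hence for maximal \<open>\<A>\<close> the family of all \<open>f\<^sub>Y\<close> is unbounded.
\<close>

context vector_space_nat_basis
begin

section \<open>Supports with respect to the fixed basis\<close>

lemma in_span_basis: "v \<in> span (range e)"
  by (simp add: span_basis)

lemma supp_zero: "supp 0 = {}"
  by (simp add: supp_def representation_zero)

lemma supp_add: "supp (v + w) \<subseteq> supp v \<union> supp w"
  by (auto simp: supp_def representation_add[OF independent_basis in_span_basis in_span_basis])

lemma supp_scale: "supp (scale c v) \<subseteq> supp v"
  by (auto simp: supp_def representation_scale[OF independent_basis in_span_basis])

lemma supp_basis: "supp (e n) = {n}"
  using inj_basis by (auto simp: supp_def representation_basis[OF independent_basis] inj_eq)

lemma finite_supp: "finite (supp v)"
proof -
  have "e ` supp v \<subseteq> {b. representation (range e) v b \<noteq> 0}"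
    by (auto simp: supp_def)
  then have "finite (e ` supp v)"
    using finite_representation finite_subset by blast
  then show ?thesis
    using inj_basis by (meson finite_imageD inj_on_subset subset_UNIV)
qed

lemma sum_supp: "(\<Sum>n\<in>supp v. scale (representation (range e) v (e n)) (e n)) = v"
proof -
  have "{b. representation (range e) v b \<noteq> 0} = e ` supp v"
    using representation_ne_zero[of "range e" v] by (auto simp: supp_def)
  then have "(\<Sum>b\<in>e ` supp v. scale (representation (range e) v b) b) = v"
    using sum_nonzero_representation_eq[OF independent_basis in_span_basis, of v] by simp
  then show ?thesis
    using inj_basis by (subst (asm) sum.reindex) (auto intro: inj_on_subset)
qed

lemma supp_eq_empty_iff: "supp v = {} \<longleftrightarrow> v = 0"
  using sum_supp[of v] by (auto simp: supp_zero)

lemma supp_span: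
  assumes "\<And>x. x \<in> S \<Longrightarrow> supp x \<subseteq> A" and "v \<in> span S"
  shows "supp v \<subseteq> A"
  using assms(2)
proof (induction rule: span_induct_alt)
  case base
  show ?case by (simp add: supp_zero)
next
  case (step c x y)
  then show ?case
    using assms(1)[of x] supp_add[of "scale c x" y] supp_scale[of c x] by blast
qed

section \<open>Coordinate truncation and cuts\<close>

definition truncate :: "nat \<Rightarrow> 'v \<Rightarrow> 'v" where
  "truncate m v = (\<Sum>n<m. scale (representation (range e) v (e n)) (e n))"

lemma truncate_zero: "truncate m 0 = 0"
  by (simp add: truncate_def representation_zero)

lemma truncate_add: "truncate m (v + w) = truncate m v + truncate m w"
  by (simp add: truncate_def representation_add[OF independent_basis in_span_basis in_span_basis]
      scale_left_distrib sum.distrib)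

lemma truncate_scale: "truncate m (scale c v) = scale c (truncate m v)"
  by (simp add: truncate_def representation_scale[OF independent_basis in_span_basis]
      scale_sum_right)

lemma truncate_eq_self:
  assumes "supp v \<subseteq> {..<m}"
  shows "truncate m v = v"
proof -
  have "truncate m v = (\<Sum>n\<in>supp v. scale (representation (range e) v (e n)) (e n))"
    unfolding truncate_def
    by (rule sum.mono_neutral_right) (use assms in \<open>auto simp: supp_def\<close>)
  then show ?thesis by (simp add: sum_supp)
qed

lemma truncate_eq_0:
  assumes "supp v \<subseteq> {m..}"
  shows "truncate m v = 0"
proof -
  have "representation (range e) v (e n) = 0" if "n < m" for n
    using assms that by (force simp: supp_def)
  then show ?thesis by (simp add: truncate_def)
qed

definition cut :: "'v set \<Rightarrow> nat \<Rightarrow> bool" where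
  "cut Y m \<longleftrightarrow> (\<forall>v\<in>Y. truncate m v \<in> Y)"

text \<open>Truncation is linear, so only generators matter, and truncating at \<open>m\<close>
  keeps each of them whole or sends it to 0.\<close>

lemma cut_span:
  assumes "\<And>x. x \<in> S \<Longrightarrow> supp x \<subseteq> {..<m} \<or> supp x \<subseteq> {m..}"
  shows "cut (span S) m"
  unfolding cut_def
proof
  fix v assume "v \<in> span S"
  then show "truncate m v \<in> span S"
  proof (induction rule: span_induct_alt)
    case base
    show ?case by (simp add: truncate_zero span_zero)
  next
    case (step c x y)
    have "truncate m x \<in> span S"
      using assms[OF step(1)] step(1)
      by (auto simp: truncate_eq_self truncate_eq_0 span_zero span_base)
    then show ?case
      using step(2) by (simp add: truncate_add truncate_scale span_add span_scale)
  qed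
qed

section \<open>Block sequences and block subspaces\<close>

lemma block_sequence_nonzero: "block_sequence x \<Longrightarrow> x n \<noteq> 0"
  by (simp add: block_sequence_def)

lemma Max_supp_in: "v \<noteq> 0 \<Longrightarrow> Max (supp v) \<in> supp v"
  by (simp add: finite_supp supp_eq_empty_iff)

lemma Max_supp_ge: "n \<in> supp v \<Longrightarrow> n \<le> Max (supp v)"
  by (simp add: finite_supp)

lemma block_sequence_iff:
  "block_sequence x \<longleftrightarrow>
    (\<forall>n. x n \<noteq> 0) \<and> (\<forall>n. supp (x (Suc n)) \<subseteq> {Suc (Max (supp (x n)))..})"
proof -
  have "block_less v w \<longleftrightarrow> supp w \<subseteq> {Suc (Max (supp v))..}" if "w \<noteq> 0" for v w
    using that by (simp add: block_less_def finite_supp supp_eq_empty_iff subset_iff Ball_def Suc_le_eq)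
  then show ?thesis
    unfolding block_sequence_def by metis
qed

lemma block_sequence_supp:
  assumes "block_sequence x" and "i < j"
  shows "supp (x j) \<subseteq> {Suc (Max (supp (x i)))..}"
  using assms(2)
proof (induction j)
  case (Suc j)
  have *: "supp (x (Suc j)) \<subseteq> {Suc (Max (supp (x j)))..}"
    using assms(1) by (simp add: block_sequence_iff)
  show ?case
  proof (cases "i = j")
    case False
    then have "Max (supp (x j)) \<in> {Suc (Max (supp (x i)))..}"
      using Suc Max_supp_in[OF block_sequence_nonzero[OF assms(1)], of j] by auto
    with * show ?thesis by auto
  qed (use * in simp)
qed simp

lemma block_sequence_supp_ge:
  assumes "block_sequence x"
  shows "supp (x n) \<subseteq> {n..}"
proof (induction n)
  case (Suc n)
  have "n \<le> Max (supp (x n))"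
    using Suc Max_supp_in[OF block_sequence_nonzero[OF assms], of n] by auto
  then show ?case
    using block_sequence_supp[OF assms, of n "Suc n"] by auto
qed simp

lemma block_sequence_le_Max:
  assumes "block_sequence x"
  shows "n \<le> Max (supp (x n))"
  using block_sequence_supp_ge[OF assms, of n] Max_supp_in[OF block_sequence_nonzero[OF assms], of n]
  by auto

text \<open>The position just past the support of \<open>y n\<close> splits no generator, and it is
  at least \<open>n\<close> because supports move right at every step.\<close>

lemma block_subspace_cut:
  assumes "block_subspace Y"
  shows "\<exists>m\<ge>n. cut Y m"
proof -
  obtain y where y: "block_sequence y" "Y = span (range y)"
    using assms by (auto simp: block_subspace_def)
  let ?m = "Suc (Max (supp (y n)))"
  have "cut Y ?m"
    unfolding y(2)
  proof (rule cut_span)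
    fix x assume "x \<in> range y"
    then obtain i where i: "x = y i" by auto
    show "supp x \<subseteq> {..<?m} \<or> supp x \<subseteq> {?m..}"
    proof (cases "n < i")
      case True
      then show ?thesis using block_sequence_supp[OF y(1)] i by blast
    next
      case False
      have "Max (supp (y i)) \<le> Max (supp (y n))"
      proof (cases "i = n")
        case neq: False
        with False have "i < n" by simp
        then show ?thesis
          using block_sequence_supp[OF y(1)] Max_supp_in[OF block_sequence_nonzero[OF y(1)], of n]
          by fastforce
      qed simp
      then have "supp x \<subseteq> {..<?m}"
        using Max_supp_ge[of _ "y i"] i by fastforce
      then show ?thesis ..
    qed
  qed
  moreover have "n \<le> ?m"
    using block_sequence_le_Max[OF y(1), of n] by simp
  ultimately show ?thesis by blast
qed

lemma block_subspace_far_vector: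
  assumes "block_subspace Y"
  shows "\<exists>v\<in>Y. v \<noteq> 0 \<and> supp v \<subseteq> {n..}"
proof -
  obtain y where y: "block_sequence y" "Y = span (range y)"
    using assms by (auto simp: block_subspace_def)
  then show ?thesis
    using block_sequence_supp_ge[OF y(1), of n] block_sequence_nonzero[OF y(1), of n]
    by (auto intro!: bexI[of _ "y n"] span_base)
qed

section \<open>Finite-dimensional and almost disjoint subspaces\<close>

lemma finite_dim_supp_bounded:
  assumes "finite_dim W"
  shows "\<exists>N. \<forall>v\<in>W. supp v \<subseteq> {..<N}"
proof -
  obtain B where B: "finite B" "span B = W"
    using assms by (auto simp: finite_dim_def)
  have "finite (\<Union>b\<in>B. supp b)"
    using B(1) finite_supp by blast
  then obtain N where N: "(\<Union>b\<in>B. supp b) \<subseteq> {..<N}"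
    using finite_nat_iff_bounded by blast
  have "supp v \<subseteq> {..<N}" if "v \<in> W" for v
    by (rule supp_span[of B]) (use N B(2) that in auto)
  then show ?thesis by blast
qed

text \<open>A basis of \<open>W\<close> is an independent subset of \<open>span B\<close>, hence
  finite.\<close>

lemma finite_dim_subspace:
  assumes "subspace W" and "finite B" and "W \<subseteq> span B"
  shows "finite_dim W"
proof -
  obtain C where C: "C \<subseteq> W" "independent C" "W \<subseteq> span C"
    by (rule basis_exists[of W])
  have "finite C"
    using independent_span_bound[OF assms(2) C(2)] C(1) assms(3) by blast
  moreover have "span C = W"
    using C(1,3) assms(1) span_minimal by blast
  ultimately show ?thesis
    unfolding finite_dim_def by blast
qed

text \<open>Finite dimension bounds all supports, but block subspaces contain nonzero vectors
  arbitrarily far out.\<close>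

lemma block_subspace_not_finite_dim:
  assumes "block_subspace Y"
  shows "\<not> finite_dim Y"
proof
  assume "finite_dim Y"
  then obtain N where N: "\<forall>v\<in>Y. supp v \<subseteq> {..<N}"
    using finite_dim_supp_bounded by blast
  obtain v where v: "v \<in> Y" "v \<noteq> 0" "supp v \<subseteq> {N..}"
    using block_subspace_far_vector[OF assms] by blast
  with N have "supp v = {}" by fastforce
  with v(2) show False by (simp add: supp_eq_empty_iff)
qed

lemma almost_disjoint_sym: "almost_disjoint X Y \<Longrightarrow> almost_disjoint Y X"
  by (simp add: almost_disjoint_def Int_commute)

text \<open>The cut after \<open>z k\<close> separates the \<open>z (Suc k)\<close> summand of a
  vector of \<open>Y\<close> from the earlier ones and leaves both parts in \<open>Y\<close>. As
  \<open>z (Suc k)\<close> is not in \<open>Y\<close>, its coefficient vanishes. Descending in this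
  way stops at \<open>z K\<close>.\<close>

lemma almost_disjoint_of_cuts:
  assumes z: "block_sequence z" and Y: "subspace Y"
    and avoid: "\<And>k. K < k \<Longrightarrow> z k \<notin> Y"
    and cuts: "\<And>k. K \<le> k \<Longrightarrow> \<exists>m. cut Y m \<and> Max (supp (z k)) < m \<and> supp (z (Suc k)) \<subseteq> {m..}"
  shows "almost_disjoint (span (range z)) Y"
proof -
  have strip: "v \<in> span (z ` {..K})" if "v \<in> span (z ` {..K + n})" "v \<in> Y" for v n
    using that
  proof (induction n arbitrary: v)
    case (Suc n)
    let ?k = "K + n"
    have "z ` {..K + Suc n} = insert (z (Suc ?k)) (z ` {..?k})"
      by (simp add: atMost_Suc)
    then obtain c where c: "v - scale c (z (Suc ?k)) \<in> span (z ` {..?k})"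
      using Suc.prems(1) by (auto simp: span_insert)
    define w where "w = v - scale c (z (Suc ?k))"
    obtain m where m: "cut Y m" "Max (supp (z ?k)) < m" "supp (z (Suc ?k)) \<subseteq> {m..}"
      using cuts[of ?k] by auto
    have "supp w \<subseteq> {..<m}"
    proof (rule supp_span)
      show "w \<in> span (z ` {..?k})" using c by (simp add: w_def)
      fix x assume "x \<in> z ` {..?k}"
      then obtain i where i: "x = z i" "i \<le> ?k" by auto
      have "Max (supp (z i)) \<le> Max (supp (z ?k))"
      proof (cases "i = ?k")
        case False
        with i have "i < ?k" by simp
        then show ?thesis
          using block_sequence_supp[OF z] Max_supp_in[OF block_sequence_nonzero[OF z], of ?k]
          by fastforce
      qed simp
      then show "supp x \<subseteq> {..<m}"
        using Max_supp_ge[of _ "z i"] i m(2) by fastforce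
    qed
    moreover have "supp (scale c (z (Suc ?k))) \<subseteq> {m..}"
      using supp_scale m(3) by blast
    ultimately have "truncate m (w + scale c (z (Suc ?k))) = w"
      by (simp add: truncate_add truncate_eq_self truncate_eq_0 del: add_Suc_right)
    then have "truncate m v = w" by (simp add: w_def)
    then have "w \<in> Y"
      using m(1) Suc.prems(2) by (auto simp: cut_def)
    then have "scale c (z (Suc ?k)) \<in> Y"
      using subspace_diff[OF Y Suc.prems(2)] by (force simp: w_def)
    \<comment> \<open>For nonzero \<open>c\<close> this vector is \<open>z (Suc ?k)\<close>, which
      \<open>avoid\<close> excludes from \<open>Y\<close>.\<close>
    then have "scale (inverse c) (scale c (z (Suc ?k))) \<in> Y"
      by (rule subspace_scale[OF Y])
    then have "c = 0"
      using avoid[of "Suc ?k"] by (cases "c = 0") simp_all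
    then show ?case
      using c Suc by simp
  qed simp
  have "span (range z) \<inter> Y \<subseteq> span (z ` {..K})"
  proof
    fix v assume v: "v \<in> span (range z) \<inter> Y"
    then have "v \<in> span (range z)" ..
    then have "\<exists>n. v \<in> span (z ` {..K + n})"
    proof (induction rule: span_induct_alt)
      case base
      show ?case using span_zero by blast
    next
      case (step c x y)
      obtain i n where i: "x = z i" and n: "y \<in> span (z ` {..K + n})"
        using step by blast
      \<comment> \<open>The bound \<open>K + (i + n)\<close> covers both the new index
        \<open>i\<close> and the old range.\<close>
      have "x \<in> span (z ` {..K + (i + n)})"
        using i by (auto intro: span_base)
      moreover have "y \<in> span (z ` {..K + (i + n)})"
        using n span_mono[of "z ` {..K + n}" "z ` {..K + (i + n)}"] by fastforce
      ultimately show ?case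
        using span_add span_scale by blast
    qed
    with v strip show "v \<in> span (z ` {..K})" by blast
  qed
  then show ?thesis
    unfolding almost_disjoint_def
    by (intro finite_dim_subspace[of _ "z ` {..K}"] subspace_inter subspace_span Y) simp_all
qed

section \<open>Diagonalization against a bounded family\<close>

lemma not_mad_if_bounded:
  assumes ad: "ad_family \<A>" and X: "inj X" "range X \<subseteq> \<A>"
    and f: "\<And>Y k. Y \<in> \<A> \<Longrightarrow> X k \<noteq> Y \<Longrightarrow> \<forall>v\<in>X k \<inter> Y. supp v \<subseteq> {..<f Y k}"
      "\<And>Y k. Y \<in> \<A> \<Longrightarrow> \<exists>m. k \<le> m \<and> m \<le> f Y k \<and> cut Y m"
    and bounded: "bounded_family (f ` \<A>)"
  shows "\<not> mad_family \<A>"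
proof
  assume mad: "mad_family \<A>"
  have block: "block_subspace Y" if "Y \<in> \<A>" for Y
    using ad that by (simp add: ad_family_def)
  obtain h where h: "\<And>Y. Y \<in> \<A> \<Longrightarrow> f Y <\<^sup>* h"
    using bounded by (auto simp: bounded_family_def)
  define P where "P k v \<longleftrightarrow> v \<in> X k \<and> v \<noteq> 0 \<and> supp v \<subseteq> {h k..}" for k v
  \<comment> \<open>The first inclusion gives the block condition; the second leaves room before
    \<open>w\<close> for a cut at or after the end of \<open>v\<close>.\<close>
  define Q where "Q v w \<longleftrightarrow>
    supp w \<subseteq> {Suc (Max (supp v))..} \<and> supp w \<subseteq> {h (Suc (Max (supp v)))..}" for v w
  have "\<exists>z. \<forall>k. P k (z k) \<and> Q (z k) (z (Suc k))"
  proof (rule dependent_nat_choice)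
    show "\<exists>v. P 0 v"
      using block_subspace_far_vector[OF block, of "X 0"] X(2) unfolding P_def by blast
    fix v k
    let ?M = "Suc (Max (supp v))"
    \<comment> \<open>The sum dominates the three lower bounds required by \<open>P\<close> and
      \<open>Q\<close>.\<close>
    obtain w where "w \<in> X (Suc k)" "w \<noteq> 0" "supp w \<subseteq> {h (Suc k) + ?M + h ?M..}"
      using block_subspace_far_vector[OF block, of "X (Suc k)"] X(2) by blast
    then have "P (Suc k) w \<and> Q v w" unfolding P_def Q_def by fastforce
    then show "\<exists>w. P (Suc k) w \<and> Q v w" ..
  qed
  then obtain z where z: "\<And>k. P k (z k)" "\<And>k. Q (z k) (z (Suc k))" by blast
  have bz: "block_sequence z"
    using z unfolding block_sequence_iff P_def Q_def by blast
  define Z where "Z = span (range z)"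
  have Z: "block_subspace Z"
    using bz unfolding block_subspace_def Z_def by blast
  have ad_Z: "almost_disjoint Z Y" if Y: "Y \<in> \<A>" for Y
  proof -
    obtain N where N: "\<And>n. N \<le> n \<Longrightarrow> f Y n < h n"
      using h[OF Y] by (auto simp: eventually_less_def)
    \<comment> \<open>By injectivity \<open>Y\<close> equals at most one \<open>X k\<close>; take
      \<open>j\<close> to be that index, if any.\<close>
    obtain j where j: "\<And>k. j < k \<Longrightarrow> X k \<noteq> Y"
      using X(1) by (metis injD less_irrefl)
    show ?thesis
      unfolding Z_def
    proof (rule almost_disjoint_of_cuts[OF bz, where K = "max N j"])
      show "subspace Y"
        using block[OF Y] by (auto simp: block_subspace_def subspace_span)
    next
      fix k assume k: "max N j < k"
      show "z k \<notin> Y"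
      proof
        assume "z k \<in> Y"
        then have "supp (z k) \<subseteq> {..<f Y k}"
          using f(1)[OF Y j, of k] k z(1)[of k] by (auto simp: P_def)
        moreover have "supp (z k) \<subseteq> {h k..}" "supp (z k) \<noteq> {}"
          using z(1)[of k] by (auto simp: P_def supp_eq_empty_iff)
        ultimately show False
          using N[of k] k by fastforce
      qed
    next
      fix k assume k: "max N j \<le> k"
      let ?M = "Suc (Max (supp (z k)))"
      obtain m where m: "?M \<le> m" "m \<le> f Y ?M" "cut Y m"
        using f(2)[OF Y] by blast
      \<comment> \<open>Domination is used at \<open>?M\<close> instead of \<open>k\<close>; it
        applies because \<open>k \<le> Max (supp (z k))\<close> puts \<open>?M\<close> above
        \<open>N\<close>.\<close>
      have "m \<le> h ?M"
        using m(2) N[of ?M] block_sequence_le_Max[OF bz, of k] k by linarith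
      then have "supp (z (Suc k)) \<subseteq> {m..}"
        using z(2)[of k] by (fastforce simp: Q_def)
      with m show "\<exists>m. cut Y m \<and> Max (supp (z k)) < m \<and> supp (z (Suc k)) \<subseteq> {m..}"
        by (auto simp: Suc_le_eq)
    qed
  qed
  \<comment> \<open>Otherwise \<open>Z\<close> would be almost disjoint from itself, hence
    finite-dimensional.\<close>
  have "Z \<notin> \<A>"
    using ad_Z[of Z] block_subspace_not_finite_dim[OF Z] by (auto simp: almost_disjoint_def)
  moreover have "ad_family (insert Z \<A>)"
    using ad Z ad_Z by (auto simp: ad_family_def pairwise_insert intro: almost_disjoint_sym)
  ultimately show False
    using mad unfolding mad_family_def by blast
qed

lemma bounding_number_le_infinite_mad:
  assumes mad: "mad_family \<A>" and inf: "infinite \<A>"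
  shows "\<bb> \<le>o |\<A>|"
proof -
  have ad: "ad_family \<A>"
    using mad by (simp add: mad_family_def)
  obtain X :: "nat \<Rightarrow> 'v set" where X: "inj X" "range X \<subseteq> \<A>"
    using infinite_countable_subset[OF inf] by blast
  have "\<exists>n. (X k \<noteq> Y \<longrightarrow> (\<forall>v\<in>X k \<inter> Y. supp v \<subseteq> {..<n})) \<and> (\<exists>m. k \<le> m \<and> m \<le> n \<and> cut Y m)"
    if Y: "Y \<in> \<A>" for Y k
  proof -
    obtain m where m: "k \<le> m" "cut Y m"
      using block_subspace_cut ad Y unfolding ad_family_def by blast
    have "\<exists>N. X k \<noteq> Y \<longrightarrow> (\<forall>v\<in>X k \<inter> Y. supp v \<subseteq> {..<N})"
    proof (cases "X k = Y")
      case False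
      then have "finite_dim (X k \<inter> Y)"
        using ad X(2) Y unfolding ad_family_def pairwise_def almost_disjoint_def by blast
      from finite_dim_supp_bounded[OF this] show ?thesis by blast
    qed simp
    then obtain N where "X k \<noteq> Y \<longrightarrow> (\<forall>v\<in>X k \<inter> Y. supp v \<subseteq> {..<N})" ..
    \<comment> \<open>Both requirements on the value of \<open>f\<close> persist when it grows, so
      \<open>N + m\<close> meets both.\<close>
    then have "X k \<noteq> Y \<longrightarrow> (\<forall>v\<in>X k \<inter> Y. supp v \<subseteq> {..<N + m})"
      by fastforce
    moreover have "k \<le> m \<and> m \<le> N + m \<and> cut Y m"
      using m by simp
    ultimately show ?thesis by blast
  qed
  then obtain f where f: "\<And>Y k. Y \<in> \<A> \<Longrightarrow> X k \<noteq> Y \<Longrightarrow> \<forall>v\<in>X k \<inter> Y. supp v \<subseteq> {..<f Y k}"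
      "\<And>Y k. Y \<in> \<A> \<Longrightarrow> \<exists>m. k \<le> m \<and> m \<le> f Y k \<and> cut Y m"
    by metis
  have "\<not> bounded_family (f ` \<A>)"
    using not_mad_if_bounded[OF ad X f] mad by blast
  then have "\<bb> \<le>o |f ` \<A>|"
    unfolding bounding_number_def by (intro min_card_least) simp
  then show ?thesis
    using card_of_image ordLeq_transitive by blast
qed

section \<open>Existence of infinite maximal families\<close>

text \<open>The pairing function splits the basis into infinitely many infinite pieces, whose spans
  meet only in 0.\<close>

lemma ex_infinite_ad_family: "\<exists>\<A>. ad_family \<A> \<and> infinite \<A>"
proof -
  define x where "x k i = e (prod_encode (k, i))" for k i
  define X where "X k = span (range (x k))" for k
  have supp_x: "supp (x k i) = {prod_encode (k, i)}" for k i
    by (simp add: x_def supp_basis)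
  \<comment> \<open>\<open>prod_encode (k, i)\<close> is strictly increasing in
    \<open>i\<close>.\<close>
  have bs: "block_sequence (x k)" for k
    unfolding block_sequence_iff supp_x supp_eq_empty_iff[symmetric]
    by (simp add: prod_encode_def)
  have block: "block_subspace (X k)" for k
    using bs unfolding block_subspace_def X_def by blast
  have disj: "X k \<inter> X l = {0}" if "k \<noteq> l" for k l
  proof -
    have supp_X: "supp v \<subseteq> range (\<lambda>i. prod_encode (k, i))" if "v \<in> X k" for v k
      by (rule supp_span[of "range (x k)"]) (use that in \<open>auto simp: supp_x X_def\<close>)
    have "v = 0" if "v \<in> X k" "v \<in> X l" for v
    proof -
      have "supp v = {}"
        using supp_X[OF that(1)] supp_X[OF that(2)] \<open>k \<noteq> l\<close> by fastforce
      then show ?thesis by (simp add: supp_eq_empty_iff)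
    qed
    then show ?thesis by (auto simp: X_def span_zero)
  qed
  have fd0: "finite_dim {0}"
    unfolding finite_dim_def by (rule exI[of _ "{}"]) simp
  have "inj X"
  proof (rule injI, rule ccontr)
    fix k l assume "X k = X l" "k \<noteq> l"
    then have "X k = {0}" using disj[of k l] by simp
    then show False using block_subspace_not_finite_dim[OF block] fd0 by metis
  qed
  then have "infinite (range X)"
    using finite_imageD infinite_UNIV_nat by blast
  moreover have "ad_family (range X)"
    unfolding ad_family_def pairwise_def almost_disjoint_def
    using block disj fd0 by (metis rangeE)
  ultimately show ?thesis by blast
qed

text \<open>Zorn's lemma is applied only to families extending an infinite one, so the maximal
  family is infinite as well.\<close>

lemma ex_infinite_mad_family: "\<exists>\<A>. mad_family \<A> \<and> infinite \<A>"
proof -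
  obtain \<A> where \<A>: "ad_family \<A>" "infinite \<A>"
    using ex_infinite_ad_family by blast
  let ?S = "{\<B>. ad_family \<B> \<and> \<A> \<subseteq> \<B>}"
  have "\<exists>M\<in>?S. \<forall>\<B>\<in>?S. M \<subseteq> \<B> \<longrightarrow> \<B> = M"
  proof (rule subset_Zorn_nonempty)
    show "?S \<noteq> {}" using \<A>(1) by blast
    fix C assume C: "C \<noteq> {}" "subset.chain ?S C"
    have mem: "\<And>\<B>. \<B> \<in> C \<Longrightarrow> ad_family \<B> \<and> \<A> \<subseteq> \<B>"
      using C(2) by (auto simp: subset.chain_def)
    \<comment> \<open>Almost disjointness concerns two members at a time, and any two lie in a
      common link of the chain.\<close>
    have "\<exists>\<B>\<in>C. V \<in> \<B> \<and> W \<in> \<B>" if "V \<in> \<Union>C" "W \<in> \<Union>C" for V W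
      using C(2) that unfolding subset_chain_def by blast
    then have "pairwise almost_disjoint (\<Union>C)"
      using mem unfolding ad_family_def pairwise_def by meson
    then have "ad_family (\<Union>C)"
      using mem unfolding ad_family_def by blast
    then show "\<Union>C \<in> ?S"
      using mem C(1) by blast
  qed
  then obtain M where "M \<in> ?S" and max: "\<forall>\<B>\<in>?S. M \<subseteq> \<B> \<longrightarrow> \<B> = M"
    by (rule bexE)
  then have M: "ad_family M" "\<A> \<subseteq> M"
    by simp_all
  have "\<not> M \<subset> \<B>" if "ad_family \<B>" for \<B>
  proof
    assume "M \<subset> \<B>"
    then show False
      using max that M(2) by force
  qed
  then have "mad_family M"
    using M(1) unfolding mad_family_def by simp
  moreover have "infinite M"
    using M(2) \<A>(2) finite_subset by metis
  ultimately show ?thesis by blast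
qed

end

text \<open>
  An infinite maximal family must be exhibited, because \<open>a_vec\<close> is a junk value if there is none.
\<close>

theorem proposition2p6:
  fixes scale :: "'f::field \<Rightarrow> 'v::ab_group_add \<Rightarrow> 'v"
    and e :: "nat \<Rightarrow> 'v"
  assumes "countable (UNIV :: 'f set)"
    and "vector_space_nat_basis scale e"
  shows "\<bb> \<le>o vector_space_nat_basis.a_vec scale e"
proof -
  interpret vector_space_nat_basis scale e by (fact assms(2))
  obtain \<A> where "mad_family \<A>" "infinite \<A>" "a_vec = |\<A>|"
    using min_card_attained[of "{\<A>. mad_family \<A> \<and> infinite \<A>}"] ex_infinite_mad_family
    unfolding a_vec_def by blast
  then show ?thesis
    using bounding_number_le_infinite_mad by simp
qed

end
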